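(* Let $G$ be a residually finite group, let $(X,d)$ be a metric space and let $G \curvearrowright_{\varphi} (X,d)$ be an isometric action, with $g \in G$ acting by the isometry $\varphi_g \colon X \to X$. Then for all finite subsets $X_0 \subset X$, all finite subsets $A \subset G$ and all $\varepsilon>0$, there exist a finite metric space $(Y,\eta)$ with an isometric action $G \curvearrowright_{\psi} (Y,\eta)$, with $g \in G$ acting by the isometry $\psi_g \colon Y \to Y$, and a map $f \colon X_0 \to Y$ such that $$\bigl|d(\varphi_g(x),\varphi_h(y)) - \eta(\psi_g(f(x)),\psi_h(f(y)))\bigr|\leq \varepsilon \quad \text{for all } g,h \in A \text{ and all } x,y\in X_0.$$
   Context: All groups are discrete. A group $G$ with identity $e$ is residually finite if for every $g\in G\setminus\{e\}$ there exist a finite group $Q$ and a homomorphism $\psi\colon G\to Q$ with $\psi(g)\neq e$. An isometric action $G\curvearrowright_\varphi (X,d)$ is a group action of $G$ on $X$ such that each $\varphi_g$ satisfies $d(\varphi_g(x),\varphi_g(y))=d(x,y)$ for all $x,y\in X$. *)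

theory Defs
  imports "HOL-Algebra.Group_Action" "HOL-Algebra.Weak_Morphisms"
    "HOL-Analysis.Abstract_Metric_Spaces"
begin

text \<open>
  HOL cannot quantify over types inside a formula, so the finite quotients \<open>Q\<close> are taken on
  carriers \<open>\<subseteq> nat\<close>. Every finite group is isomorphic to one of these, so nothing is lost;
  the lemma \<open>residually_finiteI\<close> below makes this precise.
\<close>

locale residually_finite = group G for G (structure) +
  assumes separating: "\<And>g. \<lbrakk>g \<in> carrier G; g \<noteq> \<one>\<rbrakk> \<Longrightarrow>
    \<exists>(Q :: nat monoid) \<psi>. group Q \<and> finite (carrier Q) \<and> \<psi> \<in> hom G Q \<and> \<psi> g \<noteq> \<one>\<^bsub>Q\<^esub>"

lemma residually_finiteI:
  fixes Q :: "'a \<Rightarrow> 'q monoid"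
  assumes G: "group G"
    and Q: "\<And>g. \<lbrakk>g \<in> carrier G; g \<noteq> \<one>\<^bsub>G\<^esub>\<rbrakk> \<Longrightarrow>
      group (Q g) \<and> finite (carrier (Q g)) \<and> \<psi> g \<in> hom G (Q g) \<and> \<psi> g g \<noteq> \<one>\<^bsub>Q g\<^esub>"
  shows "residually_finite G"
proof (intro residually_finite.intro residually_finite_axioms.intro G)
  fix g assume g: "g \<in> carrier G" "g \<noteq> \<one>\<^bsub>G\<^esub>"
  interpret Q: group "Q g" using Q[OF g] by blast
  obtain f :: "'q \<Rightarrow> nat" where f: "inj_on f (carrier (Q g))"
    using Q[OF g] finite_imp_inj_to_nat_seg by metis
  let ?R = "image_group f (Q g)"
  have hom: "f \<in> hom (Q g) ?R"
    by (auto simp: hom_def image_group_def inv_into_f_f[OF f])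
  have "f \<in> iso (Q g) ?R"
    using f hom by (auto simp: iso_def bij_betw_def image_group_def)
  from Q.iso_imp_img_group[OF this] have R: "group ?R"
    by (simp add: image_group_def)
  have "f \<circ> \<psi> g \<in> hom G ?R"
    using Q[OF g] hom by (auto intro: hom_compose)
  moreover have "(f \<circ> \<psi> g) g \<noteq> \<one>\<^bsub>?R\<^esub>"
    using Q[OF g] g(1) f by (auto simp: image_group_def inj_on_def hom_def)
  moreover have "finite (carrier ?R)"
    using Q[OF g] by (simp add: image_group_def)
  ultimately show "\<exists>(R :: nat monoid) \<psi>. group R \<and> finite (carrier R) \<and> \<psi> \<in> hom G R \<and> \<psi> g \<noteq> \<one>\<^bsub>R\<^esub>"
    using R by blast
qed

locale isometric_action = group_action G X \<phi> + Metric_space X d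
  for G (structure) and X and d and \<phi> +
  assumes isometric: "\<And>g x y. \<lbrakk>g \<in> carrier G; x \<in> X; y \<in> X\<rbrakk> \<Longrightarrow> d (\<phi> g x) (\<phi> g y) = d x y"

end

theory Submission
  imports Defs "HOL-Algebra.Product_Groups"
begin

text \<open>
  The action on \<open>X\<close> is first replaced by a free one. Let \<open>\<delta> = \<epsilon> / 2\<close>, let \<open>L\<close> be the word length on
  \<open>G\<close> over the letters \<open>S = A\<inverse>A \<union> {\<one>}\<close>, capped at a large number \<open>K\<close>, and put on
  \<open>G \<times> X\<^sub>0\<close>
  \<open>\<rho> ((g,x),(h,y)) = d(\<phi>\<^sub>g x, \<phi>\<^sub>h y) + \<delta> L(g\<inverse>h) + \<delta> [x \<noteq> y]\<close>.
  This is a metric invariant under left translation of the \<open>G\<close>-coordinate, its nonzero values are at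
  least \<open>\<delta>\<close>, and for \<open>g, h \<in> A\<close> it differs from \<open>d(\<phi>\<^sub>g x, \<phi>\<^sub>h y)\<close> by at most \<open>2\<delta> = \<epsilon>\<close>, because
  \<open>g\<inverse>h \<in> S\<close> has length at most \<open>1\<close>.

  The word ball of radius \<open>K\<close> is finite, so residual finiteness gives a homomorphism \<open>\<pi>\<close> from \<open>G\<close> to
  a finite group that sends no nontrivial element of this ball to the identity. The finite space is
  \<open>Y = \<pi>(G) \<times> X\<^sub>0\<close>, on which \<open>G\<close> acts by translation through \<open>\<pi>\<close>, and the distance of two points of
  \<open>Y\<close> is the infimum of \<open>\<rho>\<close> over their fibres. The fibres are the orbits of an isometric action
  of \<open>ker \<pi>\<close>, so this infimum is an invariant metric (\<open>Metric_space_fibre_dist\<close>).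

  The infimum does not shorten the distance between \<open>(a,x)\<close> and \<open>(b,y)\<close> for \<open>a, b \<in> A\<close>: other
  representatives either have the same quotient \<open>a\<inverse>b\<close>, and then the same distance, or a quotient
  \<open>a\<inverse>bn\<close> with \<open>\<one> \<noteq> n \<in> ker \<pi>\<close>. In the second case \<open>n\<close> lies outside the ball of radius \<open>K\<close>, so
  \<open>L(a\<inverse>bn) = K\<close>, and \<open>K\<close> is chosen so that \<open>\<delta>K\<close> alone is at least \<open>\<rho>((a,x),(b,y))\<close>. The word length
  is thus what keeps the infimum over the kernel under control; for a general action the infimum
  of \<open>d\<close> itself over the kernel may well be zero.
\<close>

section \<open>Finite quotients that separate a finite set from the identity\<close>

text \<open>
  Residual finiteness treats one element at a time; the product of the finitely many quotients
  treats all elements of \<open>F\<close> together.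
\<close>

lemma (in residually_finite) finite_quotient_separating:
  assumes F: "finite F" "F \<subseteq> carrier G" "\<one> \<notin> F"
  obtains Q :: "('a \<Rightarrow> nat) monoid" and \<pi>
  where "group Q" "finite (carrier Q)" "\<pi> \<in> hom G Q" "\<And>f. f \<in> F \<Longrightarrow> \<pi> f \<noteq> \<one>\<^bsub>Q\<^esub>"
proof -
  have "\<forall>f\<in>F. \<exists>Q\<psi> :: nat monoid \<times> ('a \<Rightarrow> nat). group (fst Q\<psi>) \<and> finite (carrier (fst Q\<psi>)) \<and>
      snd Q\<psi> \<in> hom G (fst Q\<psi>) \<and> snd Q\<psi> f \<noteq> \<one>\<^bsub>fst Q\<psi>\<^esub>"
  proof
    fix f assume "f \<in> F"
    then have "f \<in> carrier G" "f \<noteq> \<one>" using F by auto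
    from separating[OF this]
    show "\<exists>Q\<psi> :: nat monoid \<times> ('a \<Rightarrow> nat). group (fst Q\<psi>) \<and> finite (carrier (fst Q\<psi>)) \<and>
      snd Q\<psi> \<in> hom G (fst Q\<psi>) \<and> snd Q\<psi> f \<noteq> \<one>\<^bsub>fst Q\<psi>\<^esub>"
      by auto
  qed
  then obtain q :: "'a \<Rightarrow> nat monoid \<times> ('a \<Rightarrow> nat)" where q: "\<And>f. f \<in> F \<Longrightarrow>
      group (fst (q f)) \<and> finite (carrier (fst (q f))) \<and>
      snd (q f) \<in> hom G (fst (q f)) \<and> snd (q f) f \<noteq> \<one>\<^bsub>fst (q f)\<^esub>"
    by metis
  let ?Q = "product_group F (\<lambda>f. fst (q f))"
  let ?\<pi> = "\<lambda>g. \<lambda>f\<in>F. snd (q f) g"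
  show thesis
  proof (rule that[of ?Q ?\<pi>])
    show "group ?Q" using q by simp
    show "finite (carrier ?Q)" using q F(1) by (simp add: finite_PiE)
    show "?\<pi> \<in> hom G ?Q"
      using q by (force simp: hom_def Pi_iff PiE_iff)
    show "?\<pi> f \<noteq> \<one>\<^bsub>?Q\<^esub>" if "f \<in> F" for f
      using q[OF that] that by (auto dest: fun_cong[where x = f])
  qed
qed

section \<open>Capped word length\<close>

primrec word_ball :: "('a, 'm) monoid_scheme \<Rightarrow> 'a set \<Rightarrow> nat \<Rightarrow> 'a set" where
  "word_ball G S 0 = {\<one>\<^bsub>G\<^esub>}"
| "word_ball G S (Suc k) = word_ball G S k <#>\<^bsub>G\<^esub> S"

text \<open>
  The cap makes the length finite on elements outside the subgroup generated by \<open>S\<close>; it does not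
  affect the triangle inequality.
\<close>

definition capped_word_length :: "('a, 'm) monoid_scheme \<Rightarrow> 'a set \<Rightarrow> nat \<Rightarrow> 'a \<Rightarrow> nat" where
  "capped_word_length G S K s = (LEAST k. K \<le> k \<or> s \<in> word_ball G S k)"

locale symmetric_subset = group G for G (structure) +
  fixes S
  assumes subset: "S \<subseteq> carrier G"
    and one_mem: "\<one> \<in> S"
    and inv_mem: "s \<in> S \<Longrightarrow> inv s \<in> S"
begin

lemma word_ball_closed: "word_ball G S k \<subseteq> carrier G"
  by (induction k) (simp_all add: set_mult_closed subset)

lemma finite_word_ball: "finite S \<Longrightarrow> finite (word_ball G S k)"
  by (induction k) (auto simp: set_mult_def)

lemma word_ball_1: "word_ball G S 1 = S"
  using subset by (force simp: set_mult_def)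

lemma word_ball_mult:
  assumes "s \<in> word_ball G S i" "t \<in> word_ball G S j"
  shows "s \<otimes> t \<in> word_ball G S (i + j)"
  using assms(2)
proof (induction j arbitrary: t)
  case 0
  then show ?case using assms(1) word_ball_closed[of i] by auto
next
  case (Suc j)
  then obtain t' u where t: "t' \<in> word_ball G S j" "u \<in> S" "t = t' \<otimes> u"
    by (auto simp: set_mult_def)
  then have "s \<otimes> t = s \<otimes> t' \<otimes> u"
    using assms(1) word_ball_closed subset by (metis m_assoc subsetD)
  then show ?case using Suc.IH[OF t(1)] t(2) by (auto simp: set_mult_def)
qed

lemma word_ball_inv: "s \<in> word_ball G S k \<Longrightarrow> inv s \<in> word_ball G S k"
proof (induction k arbitrary: s)
  case 0
  then show ?case by simp
next
  case (Suc k)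
  then obtain t u where s: "t \<in> word_ball G S k" "u \<in> S" "s = t \<otimes> u"
    by (auto simp: set_mult_def)
  then have "inv s = inv u \<otimes> inv t"
    using word_ball_closed subset by (metis inv_mult_group subsetD)
  moreover have "inv u \<in> word_ball G S 1"
    using s(2) inv_mem word_ball_1 by simp
  ultimately show ?case
    using word_ball_mult[of "inv u" 1 "inv t" k] Suc.IH[OF s(1)] by simp
qed

lemma one_mem_word_ball: "\<one> \<in> word_ball G S k"
  by (induction k) (use one_mem in \<open>force simp: set_mult_def\<close>)+

lemma word_ball_mono: "i \<le> j \<Longrightarrow> word_ball G S i \<subseteq> word_ball G S j"
  using word_ball_mult[OF _ one_mem_word_ball, of _ i "j - i"] word_ball_closed[of i]
  by (auto simp: subset_iff)

lemma capped_word_length_cases: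
  "K \<le> capped_word_length G S K s \<or> s \<in> word_ball G S (capped_word_length G S K s)"
  unfolding capped_word_length_def by (rule LeastI[of _ K]) simp

lemma capped_word_length_le:
  "K \<le> k \<or> s \<in> word_ball G S k \<Longrightarrow> capped_word_length G S K s \<le> k"
  unfolding capped_word_length_def by (rule Least_le)

lemma capped_word_length_one [simp]: "capped_word_length G S K \<one> = 0"
  using capped_word_length_le[of K 0 \<one>] by simp

lemma capped_word_length_pos:
  assumes "0 < K" "s \<noteq> \<one>"
  shows "1 \<le> capped_word_length G S K s"
proof (rule ccontr)
  assume "\<not> ?thesis"
  then have "capped_word_length G S K s = 0" by simp
  then show False using capped_word_length_cases[of K s] assms by auto
qed

lemma capped_word_length_mult:
  "capped_word_length G S K (s \<otimes> t) \<le> capped_word_length G S K s + capped_word_length G S K t"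
  using capped_word_length_cases[of K s] capped_word_length_cases[of K t]
  by (intro capped_word_length_le) (auto intro: word_ball_mult)

lemma capped_word_length_inv:
  assumes "s \<in> carrier G"
  shows "capped_word_length G S K (inv s) = capped_word_length G S K s"
proof -
  have "inv s \<in> word_ball G S k \<longleftrightarrow> s \<in> word_ball G S k" for k
    using word_ball_inv[of s k] word_ball_inv[of "inv s" k] assms by auto
  then show ?thesis by (simp add: capped_word_length_def)
qed

end

section \<open>The distance between fibres\<close>

text \<open>The value \<open>0\<close> outside the image serves the requirement that a metric be nonnegative everywhere.\<close>

definition fibre_dist :: "'p set \<Rightarrow> ('p \<Rightarrow> 'p \<Rightarrow> real) \<Rightarrow> ('p \<Rightarrow> 'y) \<Rightarrow> 'y \<Rightarrow> 'y \<Rightarrow> real" where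
  "fibre_dist P \<rho> \<pi> u v =
    (if u \<in> \<pi> ` P \<and> v \<in> \<pi> ` P then Inf {\<rho> p q |p q. p \<in> P \<and> q \<in> P \<and> \<pi> p = u \<and> \<pi> q = v} else 0)"

lemma fibre_dist_le:
  assumes "\<And>p q. p \<in> P \<Longrightarrow> q \<in> P \<Longrightarrow> 0 \<le> \<rho> p q" and "p \<in> P" "q \<in> P"
  shows "fibre_dist P \<rho> \<pi> (\<pi> p) (\<pi> q) \<le> \<rho> p q"
  using assms by (auto simp: fibre_dist_def intro!: cInf_lower bdd_belowI[of _ 0])

lemma le_fibre_dist:
  assumes "p \<in> P" "q \<in> P"
    and "\<And>p' q'. \<lbrakk>p' \<in> P; q' \<in> P; \<pi> p' = \<pi> p; \<pi> q' = \<pi> q\<rbrakk> \<Longrightarrow> c \<le> \<rho> p' q'"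
  shows "c \<le> fibre_dist P \<rho> \<pi> (\<pi> p) (\<pi> q)"
proof -
  have "c \<le> Inf {\<rho> p' q' |p' q'. p' \<in> P \<and> q' \<in> P \<and> \<pi> p' = \<pi> p \<and> \<pi> q' = \<pi> q}"
    using assms by (intro cInf_greatest) blast+
  then show ?thesis using assms by (simp add: fibre_dist_def)
qed

text \<open>
  An infimum over pairs of points need not satisfy the triangle inequality. It does here because
  the fibres are equidistant in the sense of \<open>transport\<close>: a segment from \<open>p\<close> to \<open>q\<close> can be moved so
  that it starts at any other point over \<open>\<pi> p\<close>, and two segments that meet only after projection
  can therefore be joined upstairs.
\<close>

lemma Metric_space_fibre_dist:
  fixes \<rho> :: "'p \<Rightarrow> 'p \<Rightarrow> real" and \<pi> :: "'p \<Rightarrow> 'y"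
  assumes nonneg: "\<And>p q. p \<in> P \<Longrightarrow> q \<in> P \<Longrightarrow> 0 \<le> \<rho> p q"
    and refl: "\<And>p. p \<in> P \<Longrightarrow> \<rho> p p = 0"
    and sym: "\<And>p q. p \<in> P \<Longrightarrow> q \<in> P \<Longrightarrow> \<rho> p q = \<rho> q p"
    and triangle: "\<And>p q r. p \<in> P \<Longrightarrow> q \<in> P \<Longrightarrow> r \<in> P \<Longrightarrow> \<rho> p r \<le> \<rho> p q + \<rho> q r"
    and sep: "0 < \<delta>" "\<And>p q. p \<in> P \<Longrightarrow> q \<in> P \<Longrightarrow> \<pi> p \<noteq> \<pi> q \<Longrightarrow> \<delta> \<le> \<rho> p q"
    and transport: "\<And>p p' q. \<lbrakk>p \<in> P; p' \<in> P; q \<in> P; \<pi> p = \<pi> p'\<rbrakk> \<Longrightarrow>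
      \<exists>q'\<in>P. \<pi> q' = \<pi> q \<and> \<rho> p' q' = \<rho> p q"
  shows "Metric_space (\<pi> ` P) (fibre_dist P \<rho> \<pi>)"
proof
  fix u v
  show "0 \<le> fibre_dist P \<rho> \<pi> u v"
    by (auto simp: fibre_dist_def nonneg intro!: cInf_greatest)
  have "{\<rho> p q |p q. p \<in> P \<and> q \<in> P \<and> \<pi> p = u \<and> \<pi> q = v} =
      {\<rho> p q |p q. p \<in> P \<and> q \<in> P \<and> \<pi> p = v \<and> \<pi> q = u}"
    using sym by blast
  then show "fibre_dist P \<rho> \<pi> u v = fibre_dist P \<rho> \<pi> v u"
    by (simp add: fibre_dist_def conj_commute)
next
  fix u v assume "u \<in> \<pi> ` P" "v \<in> \<pi> ` P"
  then obtain p q where p: "p \<in> P" "u = \<pi> p" and q: "q \<in> P" "v = \<pi> q" by auto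
  show "fibre_dist P \<rho> \<pi> u v = 0 \<longleftrightarrow> u = v"
  proof
    assume "u = v"
    then have "fibre_dist P \<rho> \<pi> u v \<le> 0"
      using fibre_dist_le[of P \<rho> p p \<pi>] nonneg refl p by auto
    moreover have "0 \<le> fibre_dist P \<rho> \<pi> u v"
      unfolding p(2) q(2) using nonneg by (intro le_fibre_dist p q)
    ultimately show "fibre_dist P \<rho> \<pi> u v = 0" by simp
  next
    assume 0: "fibre_dist P \<rho> \<pi> u v = 0"
    show "u = v"
    proof (rule ccontr)
      assume "u \<noteq> v"
      then have "\<delta> \<le> fibre_dist P \<rho> \<pi> u v"
        unfolding p(2) q(2) using sep(2) by (intro le_fibre_dist p q) auto
      with 0 sep(1) show False by simp
    qed
  qed
next
  fix u v w assume "u \<in> \<pi> ` P" "v \<in> \<pi> ` P" "w \<in> \<pi> ` P"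
  then obtain p q r where p: "p \<in> P" "u = \<pi> p" and q: "q \<in> P" "v = \<pi> q" and r: "r \<in> P" "w = \<pi> r"
    by auto
  have join: "fibre_dist P \<rho> \<pi> u w \<le> \<rho> p1 q1 + \<rho> q2 r2"
    if pqr: "p1 \<in> P" "q1 \<in> P" "\<pi> p1 = \<pi> p" "\<pi> q1 = \<pi> q" "q2 \<in> P" "r2 \<in> P" "\<pi> q2 = \<pi> q" "\<pi> r2 = \<pi> r"
    for p1 q1 q2 r2
  proof -
    obtain r1 where r1: "r1 \<in> P" "\<pi> r1 = \<pi> r2" "\<rho> q1 r1 = \<rho> q2 r2"
      using transport[of q2 q1 r2] pqr by auto
    have "fibre_dist P \<rho> \<pi> u w \<le> \<rho> p1 r1"
      using fibre_dist_le[of P \<rho> p1 r1 \<pi>] nonneg pqr r1 p r by simp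
    also have "\<dots> \<le> \<rho> p1 q1 + \<rho> q1 r1" using triangle[of p1 q1 r1] pqr r1 by simp
    finally show ?thesis using r1 by simp
  qed
  have "fibre_dist P \<rho> \<pi> u w - \<rho> p1 q1 \<le> fibre_dist P \<rho> \<pi> v w"
    if "p1 \<in> P" "q1 \<in> P" "\<pi> p1 = \<pi> p" "\<pi> q1 = \<pi> q" for p1 q1
    unfolding q(2) r(2)
    using join[OF that] by (intro le_fibre_dist q r) (fastforce simp: r(2) algebra_simps)
  then have "fibre_dist P \<rho> \<pi> u w - fibre_dist P \<rho> \<pi> v w \<le> fibre_dist P \<rho> \<pi> (\<pi> p) (\<pi> q)"
    by (intro le_fibre_dist p q) (simp add: algebra_simps)
  then show "fibre_dist P \<rho> \<pi> u w \<le> fibre_dist P \<rho> \<pi> u v + fibre_dist P \<rho> \<pi> v w"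
    using p q by simp
qed

lemma fibre_dist_invariant:
  assumes T: "\<And>p. p \<in> P \<Longrightarrow> T p \<in> P" and T': "\<And>p. p \<in> P \<Longrightarrow> T' p \<in> P"
    and inverse: "\<And>p. p \<in> P \<Longrightarrow> T (T' p) = p"
    and \<rho>: "\<And>p q. p \<in> P \<Longrightarrow> q \<in> P \<Longrightarrow> \<rho> (T p) (T q) = \<rho> p q"
    and \<pi>: "\<And>p. p \<in> P \<Longrightarrow> \<pi> (T p) = \<theta> (\<pi> p)"
    and inj: "inj_on \<theta> (\<pi> ` P)"
    and uv: "u \<in> \<pi> ` P" "v \<in> \<pi> ` P"
  shows "fibre_dist P \<rho> \<pi> (\<theta> u) (\<theta> v) = fibre_dist P \<rho> \<pi> u v"
proof -
  have image: "\<theta> u \<in> \<pi> ` P" if "u \<in> \<pi> ` P" for u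
    using that \<pi> T by force
  have eq: "\<pi> (T p) = \<theta> u \<longleftrightarrow> \<pi> p = u" if "p \<in> P" "u \<in> \<pi> ` P" for p u
    using that \<pi> inj by (auto dest: inj_onD)
  have "{\<rho> p q |p q. p \<in> P \<and> q \<in> P \<and> \<pi> p = \<theta> u \<and> \<pi> q = \<theta> v} =
      {\<rho> (T p) (T q) |p q. p \<in> P \<and> q \<in> P \<and> \<pi> (T p) = \<theta> u \<and> \<pi> (T q) = \<theta> v}"
    using T T' inverse by (metis (no_types, lifting))
  also have "\<dots> = {\<rho> p q |p q. p \<in> P \<and> q \<in> P \<and> \<pi> p = u \<and> \<pi> q = v}"
    using \<rho> eq uv by (metis (no_types, lifting))
  finally show ?thesis using uv image by (simp add: fibre_dist_def)
qed

section \<open>Isometric actions\<close>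

text \<open>Elements of \<open>BijGroup Y\<close> are extensional, hence the restriction of the action to \<open>Y\<close>.\<close>

lemma isometric_actionI:
  fixes G (structure)
  assumes "group G" and "Metric_space Y \<eta>"
    and closed: "\<And>g y. g \<in> carrier G \<Longrightarrow> y \<in> Y \<Longrightarrow> \<theta> g y \<in> Y"
    and one: "\<And>y. y \<in> Y \<Longrightarrow> \<theta> \<one> y = y"
    and mult: "\<And>g h y. \<lbrakk>g \<in> carrier G; h \<in> carrier G; y \<in> Y\<rbrakk> \<Longrightarrow> \<theta> (g \<otimes> h) y = \<theta> g (\<theta> h y)"
    and isometric: "\<And>g y z. \<lbrakk>g \<in> carrier G; y \<in> Y; z \<in> Y\<rbrakk> \<Longrightarrow> \<eta> (\<theta> g y) (\<theta> g z) = \<eta> y z"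
  shows "isometric_action G Y \<eta> (\<lambda>g. restrict (\<theta> g) Y)"
proof -
  interpret group G by fact
  interpret Metric_space Y \<eta> by fact
  have Bij: "restrict (\<theta> g) Y \<in> Bij Y" if g: "g \<in> carrier G" for g
  proof -
    have "\<theta> g (\<theta> (inv g) y) = y" "\<theta> (inv g) (\<theta> g y) = y" if "y \<in> Y" for y
      using mult[of g "inv g" y] mult[of "inv g" g y] one g that by simp_all
    then have "bij_betw (\<theta> g) Y Y"
      using g closed by (intro bij_betwI[where g = "\<theta> (inv g)"]) auto
    then show ?thesis by (simp add: Bij_def bij_betw_restrict_eq)
  qed
  have "(\<lambda>g. restrict (\<theta> g) Y) \<in> hom G (BijGroup Y)"
  proof (rule homI)
    fix g assume "g \<in> carrier G"
    then show "restrict (\<theta> g) Y \<in> carrier (BijGroup Y)"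
      using Bij by (simp add: BijGroup_def)
  next
    fix g h assume gh: "g \<in> carrier G" "h \<in> carrier G"
    have "restrict (\<theta> (g \<otimes> h)) Y = compose Y (restrict (\<theta> g) Y) (restrict (\<theta> h) Y)"
      using gh mult closed by (auto simp: compose_def fun_eq_iff)
    then show "restrict (\<theta> (g \<otimes> h)) Y = restrict (\<theta> g) Y \<otimes>\<^bsub>BijGroup Y\<^esub> restrict (\<theta> h) Y"
      using gh Bij by (simp add: BijGroup_def)
  qed
  then have "group_hom G (BijGroup Y) (\<lambda>g. restrict (\<theta> g) Y)"
    by (intro group_hom.intro group_hom_axioms.intro group_BijGroup is_group)
  then show ?thesis
    using isometric closed
    by (intro isometric_action.intro group_action.intro isometric_action_axioms.intro assms(2)) auto
qed

text \<open>Because of this, a finite space can be built on whatever type suits the construction.\<close>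

lemma isometric_action_on_nat:
  fixes \<eta> :: "'y \<Rightarrow> 'y \<Rightarrow> real"
  assumes "isometric_action G Y \<eta> \<psi>" and "finite Y"
  obtains Z :: "nat set" and \<eta>' :: "nat \<Rightarrow> nat \<Rightarrow> real" and \<psi>' and e :: "'y \<Rightarrow> nat"
  where "finite Z" "isometric_action G Z \<eta>' \<psi>'" "e \<in> Y \<rightarrow> Z"
    "\<And>g h y z. \<lbrakk>g \<in> carrier G; h \<in> carrier G; y \<in> Y; z \<in> Y\<rbrakk> \<Longrightarrow>
      \<eta>' (\<psi>' g (e y)) (\<psi>' h (e z)) = \<eta> (\<psi> g y) (\<psi> h z)"
proof -
  interpret isometric_action G Y \<eta> \<psi> by fact
  have "group G" using group_hom by (simp add: group_hom_def)
  obtain e :: "'y \<Rightarrow> nat" where e: "inj_on e Y"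
    using finite_imp_inj_to_nat_seg[OF assms(2)] by metis
  define r where "r = inv_into Y e"
  define \<eta>' where "\<eta>' m n = (if m \<in> e ` Y \<and> n \<in> e ` Y then \<eta> (r m) (r n) else 0)" for m n
  define \<theta> where "\<theta> g n = e (\<psi> g (r n))" for g n
  have r: "r (e y) = y" if "y \<in> Y" for y
    using e that by (simp add: r_def)
  have \<psi>_closed: "\<psi> g y \<in> Y" if "g \<in> carrier G" "y \<in> Y" for g y
    using element_image[OF that] by simp
  have \<psi>_one: "\<psi> \<one>\<^bsub>G\<^esub> y = y" if "y \<in> Y" for y
    using id_eq_one that by (metis restrict_apply')
  have \<eta>'_e: "\<eta>' (e y) (e z) = \<eta> y z" if "y \<in> Y" "z \<in> Y" for y z
    using that by (simp add: \<eta>'_def r)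
  have metric: "Metric_space (e ` Y) \<eta>'"
  proof
    fix m n
    show "0 \<le> \<eta>' m n" by (simp add: \<eta>'_def)
    show "\<eta>' m n = \<eta>' n m" by (simp add: \<eta>'_def commute)
  next
    fix m n assume "m \<in> e ` Y" "n \<in> e ` Y"
    then show "\<eta>' m n = 0 \<longleftrightarrow> m = n"
      using e by (auto simp: \<eta>'_e inj_on_eq_iff)
  next
    fix m n k assume "m \<in> e ` Y" "n \<in> e ` Y" "k \<in> e ` Y"
    then show "\<eta>' m k \<le> \<eta>' m n + \<eta>' n k"
      by (auto simp: \<eta>'_e triangle)
  qed
  show thesis
  proof (rule that[of "e ` Y" \<eta>' "\<lambda>g. restrict (\<theta> g) (e ` Y)" e])
    show "finite (e ` Y)" using assms(2) by simp
    show "isometric_action G (e ` Y) \<eta>' (\<lambda>g. restrict (\<theta> g) (e ` Y))"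
      using \<psi>_closed \<psi>_one composition_rule isometric
      by (intro isometric_actionI \<open>group G\<close> metric) (auto simp: \<theta>_def \<eta>'_e r)
    show "e \<in> Y \<rightarrow> e ` Y" by simp
    show "\<eta>' (restrict (\<theta> g) (e ` Y) (e y)) (restrict (\<theta> h) (e ` Y) (e z)) = \<eta> (\<psi> g y) (\<psi> h z)"
      if "g \<in> carrier G" "h \<in> carrier G" "y \<in> Y" "z \<in> Y" for g h y z
      using that \<psi>_closed by (simp add: \<theta>_def \<eta>'_e r)
  qed
qed

section \<open>Making an action free by a length function\<close>

text \<open>
  The three summands of \<open>\<rho>\<close> have separate tasks: the first carries the geometry of \<open>X\<close>, the second
  separates the points of an orbit and penalizes large group elements, and the third separates the
  orbits.
\<close>

locale length_weighted_action = isometric_action G X d \<phi> + group G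
    for G (structure) and X :: "'x set" and d and \<phi> +
  fixes X\<^sub>0 :: "'x set" and \<delta> :: real and L :: "'a \<Rightarrow> nat"
  assumes subset: "X\<^sub>0 \<subseteq> X"
    and \<delta>: "0 < \<delta>"
    and length_one: "L \<one> = 0"
    and length_pos: "\<lbrakk>g \<in> carrier G; g \<noteq> \<one>\<rbrakk> \<Longrightarrow> 1 \<le> L g"
    and length_inv: "g \<in> carrier G \<Longrightarrow> L (inv g) = L g"
    and length_mult: "\<lbrakk>g \<in> carrier G; h \<in> carrier G\<rbrakk> \<Longrightarrow> L (g \<otimes> h) \<le> L g + L h"
begin

definition P :: "('a \<times> 'x) set" where "P = carrier G \<times> X\<^sub>0"

definition \<rho> :: "'a \<times> 'x \<Rightarrow> 'a \<times> 'x \<Rightarrow> real" where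
  "\<rho> = (\<lambda>(g, x) (h, y).
    d (\<phi> g x) (\<phi> h y) + \<delta> * real (L (inv g \<otimes> h)) + (if x = y then 0 else \<delta>))"

definition translate :: "'a \<Rightarrow> 'a \<times> 'x \<Rightarrow> 'a \<times> 'x" where
  "translate g = (\<lambda>(h, x). (g \<otimes> h, x))"

lemma \<rho>_eq:
  "\<rho> (g, x) (h, y) = d (\<phi> g x) (\<phi> h y) + \<delta> * real (L (inv g \<otimes> h)) + (if x = y then 0 else \<delta>)"
  by (simp add: \<rho>_def)

lemma act_closed: "\<lbrakk>g \<in> carrier G; x \<in> X\<^sub>0\<rbrakk> \<Longrightarrow> \<phi> g x \<in> X"
  using element_image subset by blast

lemma \<rho>_nonneg: "0 \<le> \<rho> p q"
  using \<delta> by (cases p; cases q) (simp add: \<rho>_eq)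

lemma \<rho>_refl: "p \<in> P \<Longrightarrow> \<rho> p p = 0"
  using act_closed length_one by (auto simp: P_def \<rho>_eq)

lemma \<rho>_sym:
  assumes "p \<in> P" "q \<in> P"
  shows "\<rho> p q = \<rho> q p"
proof -
  obtain h x k y where p: "p = (h, x)" "h \<in> carrier G" and q: "q = (k, y)" "k \<in> carrier G"
    using assms by (auto simp: P_def)
  have "L (inv h \<otimes> k) = L (inv k \<otimes> h)"
    using length_inv[of "inv h \<otimes> k"] p q by (simp add: inv_mult_group)
  then show ?thesis by (simp add: p q \<rho>_eq commute)
qed

lemma \<rho>_triangle:
  assumes "p \<in> P" "q \<in> P" "r \<in> P"
  shows "\<rho> p r \<le> \<rho> p q + \<rho> q r"
proof -
  obtain h x k y l z where p: "p = (h, x)" "h \<in> carrier G" "x \<in> X\<^sub>0"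
    and q: "q = (k, y)" "k \<in> carrier G" "y \<in> X\<^sub>0" and r: "r = (l, z)" "l \<in> carrier G" "z \<in> X\<^sub>0"
    using assms by (auto simp: P_def)
  have "k \<otimes> (inv k \<otimes> l) = l" using q r by (simp flip: m_assoc)
  then have "inv h \<otimes> l = (inv h \<otimes> k) \<otimes> (inv k \<otimes> l)" using p q r by (simp add: m_assoc)
  then have "L (inv h \<otimes> l) \<le> L (inv h \<otimes> k) + L (inv k \<otimes> l)"
    using p q r by (simp add: length_mult)
  then have "\<delta> * real (L (inv h \<otimes> l)) \<le> \<delta> * real (L (inv h \<otimes> k)) + \<delta> * real (L (inv k \<otimes> l))"
    using \<delta> by (simp flip: distrib_left of_nat_add)
  moreover have "d (\<phi> h x) (\<phi> l z) \<le> d (\<phi> h x) (\<phi> k y) + d (\<phi> k y) (\<phi> l z)"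
    using p q r act_closed by (intro triangle) auto
  ultimately show ?thesis using \<delta> unfolding p(1) q(1) r(1) \<rho>_eq by auto
qed

lemma \<rho>_separated:
  assumes "p \<in> P" "q \<in> P" "p \<noteq> q"
  shows "\<delta> \<le> \<rho> p q"
proof -
  obtain h x k y where p: "p = (h, x)" "h \<in> carrier G" and q: "q = (k, y)" "k \<in> carrier G"
    using assms by (auto simp: P_def)
  show ?thesis
  proof (cases "x = y")
    case True
    then have "h \<noteq> k" using assms(3) p q by simp
    then have "inv h \<otimes> k \<noteq> \<one>"
      using p q by (metis inv_closed inv_equality inv_inv)
    then have "1 \<le> L (inv h \<otimes> k)"
      using length_pos p q by simp
    then have "\<delta> * 1 \<le> \<delta> * real (L (inv h \<otimes> k))"
      using \<delta> by (intro mult_left_mono) auto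
    then show ?thesis using True by (simp add: p q \<rho>_eq add_increasing)
  next
    case False
    then show ?thesis using \<delta> by (simp add: p q \<rho>_eq)
  qed
qed

lemma translate_closed: "\<lbrakk>g \<in> carrier G; p \<in> P\<rbrakk> \<Longrightarrow> translate g p \<in> P"
  by (auto simp: translate_def P_def)

lemma translate_inverse: "\<lbrakk>g \<in> carrier G; p \<in> P\<rbrakk> \<Longrightarrow> translate g (translate (inv g) p) = p"
  by (auto simp: translate_def P_def simp flip: m_assoc)

lemma \<rho>_translate:
  assumes g: "g \<in> carrier G" and "p \<in> P" "q \<in> P"
  shows "\<rho> (translate g p) (translate g q) = \<rho> p q"
proof -
  obtain h x k y where p: "p = (h, x)" "h \<in> carrier G" "x \<in> X\<^sub>0"
    and q: "q = (k, y)" "k \<in> carrier G" "y \<in> X\<^sub>0" using assms by (auto simp: P_def)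
  have "inv g \<otimes> (g \<otimes> k) = k" using g q by (simp flip: m_assoc)
  then have "inv (g \<otimes> h) \<otimes> (g \<otimes> k) = inv h \<otimes> k"
    using g p q by (simp add: inv_mult_group m_assoc)
  moreover have "d (\<phi> (g \<otimes> h) x) (\<phi> (g \<otimes> k) y) = d (\<phi> h x) (\<phi> k y)"
    using g p q subset by (simp add: composition_rule isometric act_closed subsetD)
  ultimately show ?thesis by (simp add: p q translate_def \<rho>_eq)
qed

end

section \<open>The quotient by the kernel of a homomorphism\<close>

locale quotient_action = length_weighted_action G X d \<phi> X\<^sub>0 \<delta> L + hom: group_hom G Q \<pi>
  for G (structure) and X :: "'x set" and d \<phi> X\<^sub>0 \<delta> L and Q (structure) and \<pi>
begin

definition proj :: "'a \<times> 'x \<Rightarrow> 'c \<times> 'x" where "proj = map_prod \<pi> id"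

definition \<eta> :: "'c \<times> 'x \<Rightarrow> 'c \<times> 'x \<Rightarrow> real" where "\<eta> = fibre_dist P \<rho> proj"

definition act :: "'a \<Rightarrow> 'c \<times> 'x \<Rightarrow> 'c \<times> 'x" where
  "act g = (\<lambda>(q, x). (\<pi> g \<otimes>\<^bsub>Q\<^esub> q, x))"

lemma proj_translate: "\<lbrakk>g \<in> carrier G; p \<in> P\<rbrakk> \<Longrightarrow> proj (translate g p) = act g (proj p)"
  by (auto simp: translate_def P_def proj_def act_def)

lemma Metric_space_quotient: "Metric_space (proj ` P) \<eta>"
  unfolding \<eta>_def
proof (rule Metric_space_fibre_dist[OF \<rho>_nonneg \<rho>_refl \<rho>_sym \<rho>_triangle \<delta>])
  show "\<delta> \<le> \<rho> p q" if "p \<in> P" "q \<in> P" "proj p \<noteq> proj q" for p q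
    using that \<rho>_separated by blast
  show "\<exists>q'\<in>P. proj q' = proj q \<and> \<rho> p' q' = \<rho> p q"
    if pq: "p \<in> P" "p' \<in> P" "q \<in> P" "proj p = proj p'" for p p' q
  proof -
    obtain h h' x where p: "p = (h, x)" "p' = (h', x)" "h \<in> carrier G" "h' \<in> carrier G" "\<pi> h = \<pi> h'"
      using pq by (auto simp: P_def proj_def)
    \<comment> \<open>Translation by this element of the kernel takes \<open>p\<close> to \<open>p'\<close>.\<close>
    define n where "n = h' \<otimes>\<^bsub>G\<^esub> inv\<^bsub>G\<^esub> h"
    have n: "n \<in> carrier G" "\<pi> n = \<one>\<^bsub>Q\<^esub>" using p by (simp_all add: n_def)
    have "p' = translate n p" using p by (simp add: translate_def n_def m_assoc)
    then have "\<rho> p' (translate n q) = \<rho> p q" using \<rho>_translate n pq by simp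
    moreover have "proj (translate n q) = proj q"
      using proj_translate n pq by (auto simp: act_def proj_def P_def)
    ultimately show ?thesis using translate_closed n pq by blast
  qed
qed

lemma isometric_action_quotient:
  "isometric_action G (proj ` P) \<eta> (\<lambda>g. restrict (act g) (proj ` P))"
proof (rule isometric_actionI[OF is_group Metric_space_quotient])
  show "act g u \<in> proj ` P" if "g \<in> carrier G" "u \<in> proj ` P" for g u
    using that translate_closed by (auto simp: proj_translate[symmetric])
  show "act \<one>\<^bsub>G\<^esub> u = u" if "u \<in> proj ` P" for u
    using that by (auto simp: act_def proj_def P_def)
  show "act (g \<otimes>\<^bsub>G\<^esub> h) u = act g (act h u)"
    if "g \<in> carrier G" "h \<in> carrier G" "u \<in> proj ` P" for g h u
    using that by (auto simp: act_def proj_def P_def hom.H.m_assoc)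
  show "\<eta> (act g u) (act g v) = \<eta> u v"
    if g: "g \<in> carrier G" and "u \<in> proj ` P" "v \<in> proj ` P" for g u v
    unfolding \<eta>_def
  proof (rule fibre_dist_invariant[where T = "translate g" and T' = "translate (inv\<^bsub>G\<^esub> g)"])
    show "inj_on (act g) (proj ` P)"
      using g by (auto simp: inj_on_def act_def proj_def P_def)
  qed (use that translate_closed translate_inverse \<rho>_translate proj_translate in auto)
qed

text \<open>
  Other representatives of the two classes have a quotient \<open>t\<close> that agrees with \<open>a\<inverse>b\<close> up to the
  kernel. If \<open>t = a\<inverse>b\<close>, they are a translate of the given pair, and otherwise the hypothesis
  \<open>long\<close> makes the length term alone large enough.
\<close>

lemma quotient_dist_eq:
  assumes ab: "a \<in> carrier G" "b \<in> carrier G" and xy: "x \<in> X\<^sub>0" "y \<in> X\<^sub>0"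
    and long: "\<And>t. \<lbrakk>t \<in> carrier G; \<pi> t = \<pi> (inv\<^bsub>G\<^esub> a \<otimes>\<^bsub>G\<^esub> b); t \<noteq> inv\<^bsub>G\<^esub> a \<otimes>\<^bsub>G\<^esub> b\<rbrakk> \<Longrightarrow>
      \<rho> (a, x) (b, y) \<le> \<delta> * real (L t)"
  shows "\<eta> (proj (a, x)) (proj (b, y)) = \<rho> (a, x) (b, y)"
proof (rule antisym)
  have P: "(a, x) \<in> P" "(b, y) \<in> P" using ab xy by (auto simp: P_def)
  then show "\<eta> (proj (a, x)) (proj (b, y)) \<le> \<rho> (a, x) (b, y)"
    unfolding \<eta>_def by (intro fibre_dist_le \<rho>_nonneg)
  show "\<rho> (a, x) (b, y) \<le> \<eta> (proj (a, x)) (proj (b, y))"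
    unfolding \<eta>_def
  proof (rule le_fibre_dist[OF P])
    fix p' q' assume "p' \<in> P" "q' \<in> P" "proj p' = proj (a, x)" "proj q' = proj (b, y)"
    then obtain g h where p': "p' = (g, x)" "g \<in> carrier G" "\<pi> g = \<pi> a"
      and q': "q' = (h, y)" "h \<in> carrier G" "\<pi> h = \<pi> b"
      by (auto simp: P_def proj_def)
    define t where "t = inv\<^bsub>G\<^esub> g \<otimes>\<^bsub>G\<^esub> h"
    have t: "t \<in> carrier G" "\<pi> t = \<pi> (inv\<^bsub>G\<^esub> a \<otimes>\<^bsub>G\<^esub> b)"
      using ab p' q' by (simp_all add: t_def)
    show "\<rho> (a, x) (b, y) \<le> \<rho> p' q'"
    proof (cases "t = inv\<^bsub>G\<^esub> a \<otimes>\<^bsub>G\<^esub> b")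
      case True
      have "translate (inv\<^bsub>G\<^esub> a) (a, x) = translate (inv\<^bsub>G\<^esub> g) p'"
        "translate (inv\<^bsub>G\<^esub> a) (b, y) = translate (inv\<^bsub>G\<^esub> g) q'"
        using True ab p' q' by (simp_all add: translate_def t_def)
      then have "\<rho> (a, x) (b, y) = \<rho> p' q'"
        using \<rho>_translate[of "inv\<^bsub>G\<^esub> a" "(a, x)" "(b, y)"] \<rho>_translate[of "inv\<^bsub>G\<^esub> g" p' q']
          ab xy p' q' by (simp add: P_def)
      then show ?thesis by simp
    next
      case False
      then have "\<rho> (a, x) (b, y) \<le> \<delta> * real (L t)" using long t by blast
      also have "\<dots> \<le> \<rho> p' q'" using \<delta> by (simp add: p' q' \<rho>_eq flip: t_def)
      finally show ?thesis .
    qed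
  qed
qed

end

section \<open>Finite approximation of isometric actions\<close>

theorem theorem1p1:
  fixes G :: "('g, 'm) monoid_scheme"
    and X :: "'x set" and d :: "'x \<Rightarrow> 'x \<Rightarrow> real" and \<phi> :: "'g \<Rightarrow> 'x \<Rightarrow> 'x"
    and X\<^sub>0 :: "'x set" and A :: "'g set" and \<epsilon> :: real
  assumes "residually_finite G"
    and "Metric_space X d"
    and "isometric_action G X d \<phi>"
    and "finite X\<^sub>0" and "X\<^sub>0 \<subseteq> X"
    and "finite A" and "A \<subseteq> carrier G"
    and "\<epsilon> > 0"
  shows "\<exists>(Y :: nat set) (\<eta> :: nat \<Rightarrow> nat \<Rightarrow> real) (\<psi> :: 'g \<Rightarrow> nat \<Rightarrow> nat) (f :: 'x \<Rightarrow> nat).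
    finite Y \<and> Metric_space Y \<eta> \<and> isometric_action G Y \<eta> \<psi> \<and> f \<in> X\<^sub>0 \<rightarrow> Y \<and>
    (\<forall>g\<in>A. \<forall>h\<in>A. \<forall>x\<in>X\<^sub>0. \<forall>y\<in>X\<^sub>0.
      \<bar>d (\<phi> g x) (\<phi> h y) - \<eta> (\<psi> g (f x)) (\<psi> h (f y))\<bar> \<le> \<epsilon>)"
proof -
  interpret residually_finite G by fact
  interpret isometric_action G X d \<phi> by fact
  define \<delta> where "\<delta> = \<epsilon> / 2"
  have \<delta>: "0 < \<delta>" using assms by (simp add: \<delta>_def)

  define S where "S = insert \<one>\<^bsub>G\<^esub> ((\<lambda>(a, b). inv\<^bsub>G\<^esub> a \<otimes>\<^bsub>G\<^esub> b) ` (A \<times> A))"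
  have A_carrier: "a \<in> carrier G" if "a \<in> A" for a using that assms by auto
  have AS: "inv\<^bsub>G\<^esub> a \<otimes>\<^bsub>G\<^esub> b \<in> S" if "a \<in> A" "b \<in> A" for a b
    using that by (force simp: S_def)
  interpret S: symmetric_subset G S
  proof
    show "S \<subseteq> carrier G" "\<one>\<^bsub>G\<^esub> \<in> S" using A_carrier by (auto simp: S_def)
    show "inv\<^bsub>G\<^esub> s \<in> S" if s: "s \<in> S" for s
    proof -
      consider "s = \<one>\<^bsub>G\<^esub>" | a b where "a \<in> A" "b \<in> A" "s = inv\<^bsub>G\<^esub> a \<otimes>\<^bsub>G\<^esub> b"
        using s by (auto simp: S_def)
      then show ?thesis
      proof cases
        case 1
        then show ?thesis by (simp add: S_def)
      next
        case 2
        then show ?thesis using AS[of b a] A_carrier by (simp add: inv_mult_group)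
      qed
    qed
  qed
  have "finite S" using assms by (simp add: S_def)

  let ?D = "(\<lambda>(a, b, x, y). d (\<phi> a x) (\<phi> b y)) ` (A \<times> A \<times> X\<^sub>0 \<times> X\<^sub>0)"
  have "finite ?D" using assms by simp
  then obtain M where M_upper: "\<And>r. r \<in> ?D \<Longrightarrow> r \<le> M"
    using bdd_above_finite by (meson bdd_above_def)
  have M: "d (\<phi> a x) (\<phi> b y) \<le> M" if "a \<in> A" "b \<in> A" "x \<in> X\<^sub>0" "y \<in> X\<^sub>0" for a b x y
    using that by (intro M_upper) force
  obtain K0 :: nat where K0: "M + 2 * \<delta> < real K0 * \<delta>"
    using reals_Archimedean3[OF \<delta>] by blast
  \<comment> \<open>The cap must be positive for the length to separate points, even if \<open>A\<close> or \<open>X\<^sub>0\<close> is empty.\<close>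
  define K where "K = Suc K0"
  have "0 < K" by (simp add: K_def)
  have K: "M + 2 * \<delta> \<le> \<delta> * real K"
    using K0 \<delta> by (simp add: K_def algebra_simps)
  define L where "L = capped_word_length G S K"
  have L_AA: "\<delta> * real (L (inv\<^bsub>G\<^esub> a \<otimes>\<^bsub>G\<^esub> b)) \<le> \<delta>" if "a \<in> A" "b \<in> A" for a b
  proof -
    have "L (inv\<^bsub>G\<^esub> a \<otimes>\<^bsub>G\<^esub> b) \<le> 1"
      unfolding L_def using AS[OF that] S.word_ball_1 by (intro S.capped_word_length_le) blast
    then show ?thesis using \<delta> by simp
  qed

  obtain Q :: "('g \<Rightarrow> nat) monoid" and \<pi> where Q: "group Q" "finite (carrier Q)"
    and \<pi>: "\<pi> \<in> hom G Q"
    and separates: "\<And>f. f \<in> word_ball G S K - {\<one>\<^bsub>G\<^esub>} \<Longrightarrow> \<pi> f \<noteq> \<one>\<^bsub>Q\<^esub>"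
    using finite_quotient_separating[of "word_ball G S K - {\<one>\<^bsub>G\<^esub>}"]
      S.finite_word_ball[OF \<open>finite S\<close>] S.word_ball_closed by blast
  interpret quotient_action G X d \<phi> X\<^sub>0 \<delta> L Q \<pi>
  proof (intro quotient_action.intro length_weighted_action.intro length_weighted_action_axioms.intro
      group_hom.intro group_hom_axioms.intro)
    show "1 \<le> L g" if "g \<noteq> \<one>\<^bsub>G\<^esub>" for g
      using that S.capped_word_length_pos \<open>0 < K\<close> by (simp add: L_def)
  qed (use assms Q \<pi> \<delta> is_group S.capped_word_length_inv S.capped_word_length_mult in
      \<open>simp_all add: L_def\<close>)

  \<comment> \<open>Multiplying \<open>t\<close> by \<open>s\<inverse>\<close> lengthens it by at most one letter, so separating the ball of radius
    \<open>K\<close> controls all \<open>t\<close> of length less than \<open>K\<close>.\<close>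
  have kernel_long: "K \<le> L t"
    if "t \<in> carrier G" "s \<in> S" "\<pi> t = \<pi> s" "t \<noteq> s" for s t
  proof (rule ccontr)
    have s: "s \<in> carrier G" using that S.subset by auto
    define n where "n = inv\<^bsub>G\<^esub> s \<otimes>\<^bsub>G\<^esub> t"
    have "n \<noteq> \<one>\<^bsub>G\<^esub>"
      using that s unfolding n_def by (metis inv_closed inv_equality inv_inv)
    moreover have "\<pi> n = \<one>\<^bsub>Q\<^esub>" using that s by (simp add: n_def)
    ultimately have n: "n \<notin> word_ball G S K" using separates by auto
    assume "\<not> K \<le> L t"
    then have "t \<in> word_ball G S (L t)" "1 + L t \<le> K"
      using S.capped_word_length_cases[of K t] by (auto simp: L_def)
    moreover have "inv\<^bsub>G\<^esub> s \<in> word_ball G S 1"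
      using S.inv_mem[OF \<open>s \<in> S\<close>] unfolding S.word_ball_1 .
    ultimately have "n \<in> word_ball G S (1 + L t)"
      unfolding n_def by (intro S.word_ball_mult)
    with n S.word_ball_mono[OF \<open>1 + L t \<le> K\<close>] show False by auto
  qed

  have \<eta>_exact: "\<eta> (proj (a, x)) (proj (b, y)) = \<rho> (a, x) (b, y)"
    if "a \<in> A" "b \<in> A" "x \<in> X\<^sub>0" "y \<in> X\<^sub>0" for a b x y
  proof (rule quotient_dist_eq)
    fix t assume "t \<in> carrier G" "\<pi> t = \<pi> (inv\<^bsub>G\<^esub> a \<otimes>\<^bsub>G\<^esub> b)" "t \<noteq> inv\<^bsub>G\<^esub> a \<otimes>\<^bsub>G\<^esub> b"
    then have "K \<le> L t" using kernel_long AS[OF that(1,2)] by blast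
    have "(if x = y then 0 else \<delta>) \<le> \<delta>" using \<delta> by simp
    then have "\<rho> (a, x) (b, y) \<le> M + 2 * \<delta>"
      using M[OF that] L_AA[OF that(1,2)] unfolding \<rho>_eq by linarith
    also have "\<dots> \<le> \<delta> * real K" by (fact K)
    also have "\<dots> \<le> \<delta> * real (L t)" using \<delta> \<open>K \<le> L t\<close> by simp
    finally show "\<rho> (a, x) (b, y) \<le> \<delta> * real (L t)" .
  qed (use that A_carrier in auto)

  define f where "f x = proj (\<one>\<^bsub>G\<^esub>, x)" for x
  have f: "f x \<in> proj ` P" if "x \<in> X\<^sub>0" for x using that by (simp add: f_def P_def)
  have act_f: "restrict (act g) (proj ` P) (f x) = proj (g, x)" if "g \<in> A" "x \<in> X\<^sub>0" for g x
    using f[OF that(2)] A_carrier[OF that(1)] by (simp add: f_def act_def proj_def)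
  have approx: "\<bar>d (\<phi> g x) (\<phi> h y) -
      \<eta> (restrict (act g) (proj ` P) (f x)) (restrict (act h) (proj ` P) (f y))\<bar> \<le> \<epsilon>"
    if "g \<in> A" "h \<in> A" "x \<in> X\<^sub>0" "y \<in> X\<^sub>0" for g h x y
  proof -
    have "0 \<le> \<delta> * real (L (inv\<^bsub>G\<^esub> g \<otimes>\<^bsub>G\<^esub> h))" using \<delta> by simp
    moreover have "0 \<le> (if x = y then 0 else \<delta>)" "(if x = y then 0 else \<delta>) \<le> \<delta>" using \<delta> by auto
    moreover have "\<epsilon> = 2 * \<delta>" by (simp add: \<delta>_def)
    ultimately show ?thesis
      using L_AA[OF that(1,2)]
      unfolding act_f[OF that(1,3)] act_f[OF that(2,4)] \<eta>_exact[OF that] \<rho>_eq by linarith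
  qed

  have "proj ` P \<subseteq> carrier Q \<times> X\<^sub>0" by (auto simp: proj_def P_def)
  then have "finite (proj ` P)" using Q(2) assms(4) by (meson finite_SigmaI finite_subset)
  from isometric_action_on_nat[OF isometric_action_quotient this]
  obtain Z :: "nat set" and \<eta>' :: "nat \<Rightarrow> nat \<Rightarrow> real" and \<psi>' and e
    where Z: "finite Z" "isometric_action G Z \<eta>' \<psi>'" and e: "e \<in> proj ` P \<rightarrow> Z"
      and transfer: "\<And>g h y z. \<lbrakk>g \<in> carrier G; h \<in> carrier G; y \<in> proj ` P; z \<in> proj ` P\<rbrakk> \<Longrightarrow>
        \<eta>' (\<psi>' g (e y)) (\<psi>' h (e z)) =
        \<eta> (restrict (act g) (proj ` P) y) (restrict (act h) (proj ` P) z)"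
    by metis
  have "Metric_space Z \<eta>'" using Z(2) by (simp add: isometric_action_def)
  moreover have "e \<circ> f \<in> X\<^sub>0 \<rightarrow> Z" using e f by auto
  moreover have "\<bar>d (\<phi> g x) (\<phi> h y) - \<eta>' (\<psi>' g ((e \<circ> f) x)) (\<psi>' h ((e \<circ> f) y))\<bar> \<le> \<epsilon>"
    if "g \<in> A" "h \<in> A" "x \<in> X\<^sub>0" "y \<in> X\<^sub>0" for g h x y
    using approx[OF that] transfer[of g h "f x" "f y"] that A_carrier f by simp
  ultimately show ?thesis using Z by blast
qed

end
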